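(* Every $\Phi_{(3)}$-superstrongly unstable ($\Phi_{(3)}$-SSU) Riemannian manifold $M$ is $p$-superstrongly unstable ($p$-SSU) for every $2\le p\le 6$.
   Context: A Riemannian manifold $M^m$ is $\Phi_{(3)}$-SSU if there is an isometric immersion of $M$ in some $\mathbb R^q$ with second fundamental form $B$ such that for every $x\in M$ and every unit tangent vector $v\in T_xM$, $$F_{\Phi_{(3)},x}(v)=\sum_{i=1}^m\big(6\langle B(v,e_i),B(v,e_i)\rangle-\langle B(v,v),B(e_i,e_i)\rangle\big)<0,$$ where $\{e_1,\dots,e_m\}$ is a local orthonormal frame near $x$. For $p\ge2$, $M^m$ is $p$-SSU if there is an isometric immersion of $M$ in some $\mathbb R^q$ with second fundamental form $B$ such that for every $x\in M$ and every unit $v\in T_xM$, $$F_{p,x}(v)=(p-2)\langle B(v,v),B(v,v)\rangle+\sum_{i=1}^m\big(2\langle B(v,e_i),B(v,e_i)\rangle-\langle B(v,v),B(e_i,e_i)\rangle\big)<0 .$$ *)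

theory Defs
  imports "HOL-Analysis.Analysis"
begin

section \<open>Smooth functions on open subsets of coordinate space\<close>

definition partial_deriv :: "'m::finite \<Rightarrow> (real^'m \<Rightarrow> real) \<Rightarrow> real^'m \<Rightarrow> real" where
  "partial_deriv i h = (\<lambda>y. frechet_derivative h (at y) (axis i 1))"

text \<open>\<open>C_k_on k S h\<close>: \<open>h\<close> is of class \<open>C\<^sup>k\<close> on the set \<open>S\<close>, which is meant to be open.\<close>

primrec C_k_on :: "nat \<Rightarrow> (real^'m::finite) set \<Rightarrow> (real^'m \<Rightarrow> real) \<Rightarrow> bool" where
  "C_k_on 0 S h \<longleftrightarrow> continuous_on S h"
| "C_k_on (Suc k) S h \<longleftrightarrow> (\<forall>y\<in>S. h differentiable (at y)) \<and> (\<forall>i. C_k_on k S (partial_deriv i h))"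

definition smooth_fun_on :: "(real^'m::finite) set \<Rightarrow> (real^'m \<Rightarrow> real) \<Rightarrow> bool" where
  "smooth_fun_on S h \<longleftrightarrow> (\<forall>k. C_k_on k S h)"

section \<open>Riemannian manifolds\<close>

text \<open>
  A chart is a pair of its domain in the manifold and its coordinate map. The dimension \<open>m\<close> of
  the manifold is the cardinality of the index type \<open>'m\<close>. A tangent vector at \<open>x\<close> is given by a
  chart around \<open>x\<close> together with its component vector in \<open>real^'m\<close> with respect to the coordinate
  basis of that chart; the components in different charts are related by the derivative of the
  transition map.
\<close>

type_synonym ('a, 'm) chart = "'a set \<times> ('a \<Rightarrow> real^'m)"

definition chart_image :: "('a, 'm::finite) chart \<Rightarrow> (real^'m) set" where
  "chart_image c = snd c ` fst c"

definition chart_inv :: "('a, 'm::finite) chart \<Rightarrow> real^'m \<Rightarrow> 'a" where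
  "chart_inv c = inv_into (fst c) (snd c)"

definition chart_on :: "'a topology \<Rightarrow> ('a, 'm::finite) chart \<Rightarrow> bool" where
  "chart_on X c \<longleftrightarrow>
     openin X (fst c) \<and> open (chart_image c) \<and>
     homeomorphic_map (subtopology X (fst c)) (top_of_set (chart_image c)) (snd c)"

definition smoothly_compatible :: "('a, 'm::finite) chart \<Rightarrow> ('a, 'm) chart \<Rightarrow> bool" where
  "smoothly_compatible c d \<longleftrightarrow>
     (\<forall>i. smooth_fun_on (snd c ` (fst c \<inter> fst d)) (\<lambda>y. snd d (chart_inv c y) $ i))"

text \<open>
  \<open>change_of_chart c d x u\<close> are the components in the chart \<open>d\<close> of the tangent vector at \<open>x\<close>
  whose components in the chart \<open>c\<close> are \<open>u\<close>.
\<close>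

definition change_of_chart ::
  "('a, 'm::finite) chart \<Rightarrow> ('a, 'm) chart \<Rightarrow> 'a \<Rightarrow> real^'m \<Rightarrow> real^'m" where
  "change_of_chart c d x = frechet_derivative (\<lambda>y. snd d (chart_inv c y)) (at (snd c x))"

text \<open>
  \<open>metric M c x u w\<close> is the inner product of the two tangent vectors at \<open>x\<close> with components \<open>u\<close>
  and \<open>w\<close> in the chart \<open>c\<close>.
\<close>

record ('a, 'm) riem =
  mtop :: "'a topology"
  atlas :: "('a, 'm) chart set"
  metric :: "('a, 'm) chart \<Rightarrow> 'a \<Rightarrow> real^'m \<Rightarrow> real^'m \<Rightarrow> real"

definition smooth_manifold :: "('a, 'm::finite) riem \<Rightarrow> bool" where
  "smooth_manifold M \<longleftrightarrow>
     Hausdorff_space (mtop M) \<and> second_countable (mtop M) \<and>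
     (\<forall>c\<in>atlas M. chart_on (mtop M) c) \<and>
     (\<Union>c\<in>atlas M. fst c) = topspace (mtop M) \<and>
     (\<forall>c\<in>atlas M. \<forall>d\<in>atlas M. smoothly_compatible c d)"

definition riemannian_metric :: "('a, 'm::finite) riem \<Rightarrow> bool" where
  "riemannian_metric M \<longleftrightarrow>
     (\<forall>c\<in>atlas M. \<forall>x\<in>fst c.
        bilinear (metric M c x) \<and>
        (\<forall>u w. metric M c x u w = metric M c x w u) \<and>
        (\<forall>u. u \<noteq> 0 \<longrightarrow> metric M c x u u > 0)) \<and>
     (\<forall>c\<in>atlas M. \<forall>i j.
        smooth_fun_on (chart_image c)
          (\<lambda>y. metric M c (chart_inv c y) (axis i 1) (axis j 1))) \<and>
     (\<forall>c\<in>atlas M. \<forall>d\<in>atlas M. \<forall>x\<in>fst c \<inter> fst d. \<forall>u w.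
        metric M c x u w =
        metric M d x (change_of_chart c d x u) (change_of_chart c d x w))"

definition riemannian_manifold :: "('a, 'm::finite) riem \<Rightarrow> bool" where
  "riemannian_manifold M \<longleftrightarrow> smooth_manifold M \<and> riemannian_metric M"

text \<open>
  A local orthonormal frame near \<open>x\<close>, in a chart \<open>c\<close> around \<open>x\<close>: \<open>E i y\<close> are the components of
  the vector field \<open>e\<^sub>i\<close> at the point with coordinates \<open>y\<close>.
\<close>

definition local_orthonormal_frame ::
  "('a, 'm::finite) riem \<Rightarrow> ('a, 'm) chart \<Rightarrow> 'a \<Rightarrow> ('m \<Rightarrow> real^'m \<Rightarrow> real^'m) \<Rightarrow> bool" where
  "local_orthonormal_frame M c x E \<longleftrightarrow>
     (\<exists>W. open W \<and> snd c x \<in> W \<and> W \<subseteq> chart_image c \<and>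
        (\<forall>i j. smooth_fun_on W (\<lambda>y. E i y $ j)) \<and>
        (\<forall>y\<in>W. \<forall>i j. metric M c (chart_inv c y) (E i y) (E j y) = (if i = j then 1 else 0)))"

section \<open>Isometric immersions in Euclidean spaces and their second fundamental form\<close>

text \<open>
  Since the dimension \<open>q\<close> of the ambient space is existentially quantified below, its points are
  the functions in \<open>topspace (Euclidean_space q)\<close>, i.e. those vanishing at all indices \<open>\<ge> q\<close>.
\<close>

definition ip :: "nat \<Rightarrow> (nat \<Rightarrow> real) \<Rightarrow> (nat \<Rightarrow> real) \<Rightarrow> real" where
  "ip q a b = (\<Sum>k<q. a k * b k)"

definition coord_rep :: "('a, 'm::finite) chart \<Rightarrow> ('a \<Rightarrow> nat \<Rightarrow> real) \<Rightarrow> nat \<Rightarrow> real^'m \<Rightarrow> real" where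
  "coord_rep c f k = (\<lambda>y. f (chart_inv c y) k)"

definition differential ::
  "('a, 'm::finite) chart \<Rightarrow> ('a \<Rightarrow> nat \<Rightarrow> real) \<Rightarrow> 'a \<Rightarrow> real^'m \<Rightarrow> (nat \<Rightarrow> real)" where
  "differential c f x u = (\<lambda>k. frechet_derivative (coord_rep c f k) (at (snd c x)) u)"

definition smooth_map :: "('a, 'm::finite) riem \<Rightarrow> nat \<Rightarrow> ('a \<Rightarrow> nat \<Rightarrow> real) \<Rightarrow> bool" where
  "smooth_map M q f \<longleftrightarrow>
     f ` topspace (mtop M) \<subseteq> topspace (Euclidean_space q) \<and>
     (\<forall>c\<in>atlas M. \<forall>k. smooth_fun_on (chart_image c) (coord_rep c f k))"

definition isometric_immersion :: "('a, 'm::finite) riem \<Rightarrow> nat \<Rightarrow> ('a \<Rightarrow> nat \<Rightarrow> real) \<Rightarrow> bool" where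
  "isometric_immersion M q f \<longleftrightarrow>
     smooth_map M q f \<and>
     (\<forall>c\<in>atlas M. \<forall>x\<in>fst c.
        inj (differential c f x) \<and>
        (\<forall>u w. ip q (differential c f x u) (differential c f x w) = metric M c x u w))"

text \<open>The component of \<open>a\<close> orthogonal to the linear subspace \<open>T\<close> of the \<open>q\<close>-dimensional space.\<close>

definition normal_part :: "nat \<Rightarrow> (nat \<Rightarrow> real) set \<Rightarrow> (nat \<Rightarrow> real) \<Rightarrow> (nat \<Rightarrow> real)" where
  "normal_part q T a =
     (THE n. n \<in> topspace (Euclidean_space q) \<and> (\<forall>t\<in>T. ip q n t = 0) \<and> (\<lambda>k. a k - n k) \<in> T)"

text \<open>
  The derivative in direction \<open>u\<close>, with respect to the flat connection of the ambient space, of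
  the vector field \<open>df(Y)\<close> along \<open>f\<close>, where \<open>Y\<close> is the extension of the tangent vector \<open>w\<close> at \<open>x\<close>
  that has constant components in the chart \<open>c\<close>.
\<close>

definition ambient_deriv ::
  "('a, 'm::finite) chart \<Rightarrow> ('a \<Rightarrow> nat \<Rightarrow> real) \<Rightarrow> 'a \<Rightarrow> real^'m \<Rightarrow> real^'m \<Rightarrow> (nat \<Rightarrow> real)" where
  "ambient_deriv c f x u w =
     (\<lambda>k. frechet_derivative
            (\<lambda>y. frechet_derivative (coord_rep c f k) (at y) w) (at (snd c x)) u)"

text \<open>
  The second fundamental form is the normal component of that derivative; it does not depend on
  the extension of \<open>w\<close>, because changing the extension changes the derivative by a tangent vector.
\<close>

definition second_fundamental_form ::
  "nat \<Rightarrow> ('a \<Rightarrow> nat \<Rightarrow> real) \<Rightarrow> ('a, 'm::finite) chart \<Rightarrow> 'a \<Rightarrow> real^'m \<Rightarrow> real^'m \<Rightarrow> (nat \<Rightarrow> real)"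
  where
  "second_fundamental_form q f c x u w =
     normal_part q (range (differential c f x)) (ambient_deriv c f x u w)"

section \<open>Superstrongly unstable manifolds\<close>

definition F_Phi3 ::
  "nat \<Rightarrow> ('a \<Rightarrow> nat \<Rightarrow> real) \<Rightarrow> ('a, 'm::finite) chart \<Rightarrow> 'a \<Rightarrow> ('m \<Rightarrow> real^'m \<Rightarrow> real^'m)
    \<Rightarrow> real^'m \<Rightarrow> real" where
  "F_Phi3 q f c x E v =
     (let B = second_fundamental_form q f c x; e = (\<lambda>i. E i (snd c x)) in
      (\<Sum>i\<in>UNIV. 6 * ip q (B v (e i)) (B v (e i)) - ip q (B v v) (B (e i) (e i))))"

definition F_p ::
  "real \<Rightarrow> nat \<Rightarrow> ('a \<Rightarrow> nat \<Rightarrow> real) \<Rightarrow> ('a, 'm::finite) chart \<Rightarrow> 'a \<Rightarrow> ('m \<Rightarrow> real^'m \<Rightarrow> real^'m)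
    \<Rightarrow> real^'m \<Rightarrow> real" where
  "F_p p q f c x E v =
     (let B = second_fundamental_form q f c x; e = (\<lambda>i. E i (snd c x)) in
      (p - 2) * ip q (B v v) (B v v) +
      (\<Sum>i\<in>UNIV. 2 * ip q (B v (e i)) (B v (e i)) - ip q (B v v) (B (e i) (e i))))"

text \<open>
  The values of \<open>F_Phi3\<close> and \<open>F_p\<close> do not depend on the choice of the local orthonormal frame, and
  such frames exist near every point by the Gram-Schmidt process.
\<close>

definition Phi3_SSU :: "('a, 'm::finite) riem \<Rightarrow> bool" where
  "Phi3_SSU M \<longleftrightarrow>
     (\<exists>q f. isometric_immersion M q f \<and>
        (\<forall>c\<in>atlas M. \<forall>x\<in>fst c. \<forall>v. metric M c x v v = 1 \<longrightarrow>
           (\<forall>E. local_orthonormal_frame M c x E \<longrightarrow> F_Phi3 q f c x E v < 0)))"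

definition p_SSU :: "real \<Rightarrow> ('a, 'm::finite) riem \<Rightarrow> bool" where
  "p_SSU p M \<longleftrightarrow>
     (\<exists>q f. isometric_immersion M q f \<and>
        (\<forall>c\<in>atlas M. \<forall>x\<in>fst c. \<forall>v. metric M c x v v = 1 \<longrightarrow>
           (\<forall>E. local_orthonormal_frame M c x E \<longrightarrow> F_p p q f c x E v < 0)))"

end

theory Submission
  imports Defs
begin

text \<open>
  The isometric immersion witnessing \<^const>\<open>Phi3_SSU\<close> also witnesses \<^const>\<open>p_SSU\<close>, because
  \<open>F_p \<le> F_Phi3\<close> on unit vectors. The two functionals differ by
  \<open>4 * (\<Sum>i. |B(v,e\<^sub>i)|\<^sup>2) - (p - 2) * |B(v,v)|\<^sup>2\<close>, and \<open>p - 2 \<le> 4\<close>, so it is enough that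
  \<open>|B(v,v)|\<^sup>2 \<le> (\<Sum>i. |B(v,e\<^sub>i)|\<^sup>2)\<close>. To see this, expand the unit vector \<open>v\<close> in the
  orthonormal basis as \<open>v = (\<Sum>i. v\<^sub>i e\<^sub>i)\<close> with \<open>(\<Sum>i. v\<^sub>i\<^sup>2) = 1\<close> (\<open>orthonormal_expansion\<close>); then
  \<open>B(v,v) = (\<Sum>i. v\<^sub>i B(v,e\<^sub>i))\<close>, and the Cauchy-Schwarz inequality applies (\<open>ip_combination_le\<close>).

  What takes work is that \<open>B\<close> is linear in its second argument. The second derivative of the
  immersion is linear because the first derivative is a combination of partial derivatives
  (\<open>frechet_derivative_directional\<close>). The normal part, a definite description, is linear because
  it is given by the explicit formula \<open>a - (\<Sum>i. \<langle>a, df e\<^sub>i\<rangle> df e\<^sub>i)\<close>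
  (\<open>normal_part_orthonormal\<close>).
\<close>

section \<open>Orthonormal bases and normal parts\<close>

lemma ip_commute: "ip q a b = ip q b a"
  by (simp add: ip_def mult.commute)

lemma ip_diff_left: "ip q (\<lambda>k. a k - b k) c = ip q a c - ip q b c"
  by (simp add: ip_def left_diff_distrib sum_subtractf)

lemma ip_combination_left:
  "ip q (\<lambda>k. \<Sum>i\<in>I. r i * X i k) b = (\<Sum>i\<in>I. r i * ip q (X i) b)"
  unfolding ip_def sum_distrib_right sum_distrib_left
  by (subst sum.swap) (simp add: mult.assoc)

lemma ip_self_eq_0D:
  assumes "a \<in> topspace (Euclidean_space q)" and "ip q a a = 0"
  shows "a k = 0"
proof (cases "k < q")
  case True
  have "\<forall>k\<in>{..<q}. a k * a k = 0"
    using assms(2) unfolding ip_def by (subst (asm) sum_nonneg_eq_0_iff) auto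
  then show ?thesis using True by simp
qed (use assms(1) in \<open>simp add: topspace_Euclidean_space\<close>)

lemma ip_combination_le:
  assumes "(\<Sum>i\<in>I. (r i)\<^sup>2) = 1"
  shows "ip q (\<lambda>k. \<Sum>i\<in>I. r i * X i k) (\<lambda>k. \<Sum>i\<in>I. r i * X i k) \<le> (\<Sum>i\<in>I. ip q (X i) (X i))"
proof -
  have "(\<Sum>i\<in>I. r i * X i k)\<^sup>2 \<le> (\<Sum>i\<in>I. (X i k)\<^sup>2)" for k
    using Cauchy_Schwarz_ineq_sum[of r "\<lambda>i. X i k" I] assms by simp
  then have "(\<Sum>k<q. (\<Sum>i\<in>I. r i * X i k)\<^sup>2) \<le> (\<Sum>k<q. \<Sum>i\<in>I. (X i k)\<^sup>2)"
    by (intro sum_mono)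
  also have "\<dots> = (\<Sum>i\<in>I. \<Sum>k<q. (X i k)\<^sup>2)"
    by (rule sum.swap)
  finally show ?thesis
    by (simp add: ip_def power2_eq_square)
qed

text \<open>
  There are as many \<open>e i\<close> as the dimension, so the linear map sending a coefficient vector \<open>a\<close> to
  \<open>\<Sum>i. a\<^sub>i e\<^sub>i\<close> is surjective once it is injective; and \<open>a\<close> can be read off from its image by
  pairing with the \<open>e i\<close>.
\<close>

lemma orthonormal_expansion:
  fixes g :: "real^'m::finite \<Rightarrow> real^'m \<Rightarrow> real" and e :: "'m \<Rightarrow> real^'m"
  assumes g: "bilinear g" and e: "\<And>i j. g (e i) (e j) = (if i = j then 1 else 0)"
  shows "\<exists>a. v = (\<Sum>i\<in>UNIV. a i *\<^sub>R e i) \<and> g v v = (\<Sum>i\<in>UNIV. (a i)\<^sup>2)"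
proof -
  define comb :: "real^'m \<Rightarrow> real^'m" where "comb a = (\<Sum>i\<in>UNIV. a $ i *\<^sub>R e i)" for a
  have lin: "linear comb"
    by (rule linearI)
      (simp_all add: comb_def scaleR_left_distrib sum.distrib scaleR_sum_right)
  have g_left: "linear (\<lambda>u. g u w)" and g_right: "linear (g w)" for w
    using g by (auto simp: bilinear_def)
  have coeff: "g (comb a) (e j) = a $ j" for a j
    unfolding comb_def linear_sum[OF g_left] linear_scale[OF g_left] e
    by (simp add: if_distrib cong: if_cong)
  have "inj comb"
    by (rule injI) (metis coeff vec_eq_iff)
  then obtain a where a: "v = comb a"
    using linear_injective_imp_surjective[OF lin] by (metis surjD)
  have "g v v = (\<Sum>i\<in>UNIV. a $ i *\<^sub>R g v (e i))"
    by (subst (2) a) (simp add: comb_def linear_sum[OF g_right] linear_scale[OF g_right])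
  then have "g v v = (\<Sum>i\<in>UNIV. (a $ i)\<^sup>2)"
    by (simp add: a coeff power2_eq_square)
  then show ?thesis
    using a unfolding comb_def by blast
qed

text \<open>
  Two candidates for the normal part differ by a vector that is tangent and normal, hence
  orthogonal to itself.
\<close>

lemma normal_part_orthonormal:
  fixes t :: "'m::finite \<Rightarrow> nat \<Rightarrow> real"
  assumes T: "T = {\<lambda>k. \<Sum>i\<in>UNIV. r i * t i k |r. True}"
    and t: "\<And>i. t i \<in> topspace (Euclidean_space q)"
    and orth: "\<And>i j. ip q (t i) (t j) = (if i = j then 1 else 0)"
    and a: "a \<in> topspace (Euclidean_space q)"
  shows "normal_part q T a = (\<lambda>k. a k - (\<Sum>i\<in>UNIV. ip q a (t i) * t i k))"
  unfolding normal_part_def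
proof (rule the_equality, intro conjI ballI)
  let ?n = "\<lambda>k. a k - (\<Sum>i\<in>UNIV. ip q a (t i) * t i k)"
  show n: "?n \<in> topspace (Euclidean_space q)"
    using a t by (simp add: topspace_Euclidean_space)
  show n_tangent: "(\<lambda>k. a k - ?n k) \<in> T"
    unfolding T by auto
  show n_normal: "ip q ?n s = 0" if s: "s \<in> T" for s
  proof -
    have "ip q ?n (t j) = 0" for j
      by (simp add: ip_diff_left ip_combination_left orth if_distrib cong: if_cong)
    moreover obtain r where "s = (\<lambda>k. \<Sum>i\<in>UNIV. r i * t i k)"
      using s T by auto
    ultimately show ?thesis
      by (subst ip_commute) (simp add: ip_combination_left ip_commute[of q "t _"])
  qed
  fix n'
  assume n': "n' \<in> topspace (Euclidean_space q) \<and> (\<forall>s\<in>T. ip q n' s = 0) \<and> (\<lambda>k. a k - n' k) \<in> T"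
  let ?d = "\<lambda>k. n' k - ?n k"
  obtain r where r: "(\<lambda>k. a k - n' k) = (\<lambda>k. \<Sum>i\<in>UNIV. r i * t i k)"
    using n' T by auto
  have "?d = (\<lambda>k. \<Sum>i\<in>UNIV. (ip q a (t i) - r i) * t i k)"
    using fun_cong[OF r] by (auto simp: left_diff_distrib sum_subtractf algebra_simps)
  then have "?d \<in> T"
    unfolding T by (intro CollectI exI[of _ "\<lambda>i. ip q a (t i) - r i"] conjI TrueI)
  then have "ip q ?d ?d = 0"
    using n' n_normal by (simp only: ip_diff_left)
  moreover have "?d \<in> topspace (Euclidean_space q)"
    using n n' by (simp add: topspace_Euclidean_space)
  ultimately have "?d k = 0" for k
    by (rule ip_self_eq_0D[rotated])
  then show "n' = ?n"
    by auto
qed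

section \<open>Linearity of the second fundamental form\<close>

lemma frechet_derivative_eq_partial_derivs:
  fixes h :: "real^'m::finite \<Rightarrow> real"
  assumes "h differentiable (at y)"
  shows "frechet_derivative h (at y) w = (\<Sum>i\<in>UNIV. w $ i * partial_deriv i h y)"
proof -
  have lin: "linear (frechet_derivative h (at y))"
    using assms by (rule linear_frechet_derivative)
  have "frechet_derivative h (at y) w = frechet_derivative h (at y) (\<Sum>i\<in>UNIV. w $ i *\<^sub>R axis i 1)"
    by (simp only: scalar_mult_eq_scaleR[symmetric] basis_expansion)
  also have "\<dots> = (\<Sum>i\<in>UNIV. w $ i * partial_deriv i h y)"
    unfolding linear_sum[OF lin] linear_scale[OF lin] partial_deriv_def by simp
  finally show ?thesis .
qed

text \<open>
  The derivative only sees the function near \<open>y\<close>, and on the open set \<open>S\<close> the directional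
  derivative is a combination of partial derivatives with constant coefficients \<open>w $ i\<close>.
\<close>

lemma frechet_derivative_directional:
  fixes h :: "real^'m::finite \<Rightarrow> real"
  assumes S: "open S" "y \<in> S" and h: "smooth_fun_on S h"
  shows "frechet_derivative (\<lambda>z. frechet_derivative h (at z) w) (at y) u =
    (\<Sum>i\<in>UNIV. w $ i * frechet_derivative (partial_deriv i h) (at y) u)"
proof -
  have C2: "C_k_on (Suc (Suc 0)) S h"
    using h unfolding smooth_fun_on_def by blast
  then have diff: "h differentiable (at z)" if "z \<in> S" for z
    using that by simp
  have "(partial_deriv i h has_derivative frechet_derivative (partial_deriv i h) (at y)) (at y)" for i
    using C2 S(2) by (simp add: frechet_derivative_works)
  then have "((\<lambda>z. \<Sum>i\<in>UNIV. w $ i * partial_deriv i h z) has_derivative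
      (\<lambda>u. \<Sum>i\<in>UNIV. w $ i * frechet_derivative (partial_deriv i h) (at y) u)) (at y)"
    by (intro has_derivative_sum has_derivative_mult_right)
  then have "((\<lambda>z. frechet_derivative h (at z) w) has_derivative
      (\<lambda>u. \<Sum>i\<in>UNIV. w $ i * frechet_derivative (partial_deriv i h) (at y) u)) (at y)"
    by (rule has_derivative_transform_within_open[OF _ S])
      (simp add: frechet_derivative_eq_partial_derivs diff)
  from frechet_derivative_at[OF this] show ?thesis
    by (rule fun_cong[OF sym])
qed

lemma frechet_derivative_eq_0_if_zero_on_open:
  fixes h :: "real^'m::finite \<Rightarrow> real"
  assumes "open S" "y \<in> S" "\<And>z. z \<in> S \<Longrightarrow> h z = 0"
  shows "frechet_derivative h (at y) u = 0"
proof -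
  have "(h has_derivative (\<lambda>_. 0)) (at y)"
    by (rule has_derivative_transform_within_open[OF has_derivative_const[of 0] assms(1,2)])
      (simp add: assms(3))
  from frechet_derivative_at[OF this] show ?thesis
    by (rule fun_cong[OF sym])
qed

text \<open>
  Since \<open>df\<close> is isometric, it maps the basis \<open>e\<close> to an orthonormal basis of the tangent space
  \<open>range df\<close>. This makes the explicit formula for the normal part available, and that formula is
  linear in the second derivative of the immersion.
\<close>

lemma second_fundamental_form_combination:
  fixes M :: "('a, 'm::finite) riem" and e :: "'m \<Rightarrow> real^'m"
  assumes M: "riemannian_manifold M" and f: "isometric_immersion M q f"
    and c: "c \<in> atlas M" "x \<in> fst c"
    and e: "\<And>i j. metric M c x (e i) (e j) = (if i = j then 1 else 0)"
  shows "second_fundamental_form q f c x u (\<Sum>i\<in>I. r i *\<^sub>R w i) =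
    (\<lambda>k. \<Sum>i\<in>I. r i * second_fundamental_form q f c x u (w i) k)"
proof -
  let ?y = "snd c x" and ?S = "chart_image c"
  let ?t = "\<lambda>i. differential c f x (e i)"
  let ?A = "ambient_deriv c f x u"
  have chart: "chart_on (mtop M) c"
    using M c by (auto simp: riemannian_manifold_def smooth_manifold_def)
  then have S: "open ?S" "?y \<in> ?S"
    using c by (auto simp: chart_on_def chart_image_def)
  have smooth: "smooth_fun_on ?S (coord_rep c f k)" for k
    using f c by (auto simp: isometric_immersion_def smooth_map_def)
  have "C_k_on (Suc 0) ?S (coord_rep c f k)" for k
    using smooth unfolding smooth_fun_on_def by blast
  then have diff: "coord_rep c f k differentiable (at ?y)" for k
    using S(2) by simp
  have zero: "coord_rep c f k z = 0" if "q \<le> k" "z \<in> ?S" for k z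
  proof -
    have "chart_inv c z \<in> fst c"
      using that(2) unfolding chart_inv_def chart_image_def by (rule inv_into_into)
    then have "chart_inv c z \<in> topspace (mtop M)"
      using chart openin_subset unfolding chart_on_def by blast
    then have "f (chart_inv c z) \<in> topspace (Euclidean_space q)"
      using f unfolding isometric_immersion_def smooth_map_def by blast
    then show ?thesis
      using that(1) by (simp add: coord_rep_def topspace_Euclidean_space)
  qed
  have t: "?t i \<in> topspace (Euclidean_space q)" for i
    unfolding topspace_Euclidean_space differential_def
    using frechet_derivative_eq_0_if_zero_on_open[OF S zero] by auto
  have A: "?A w \<in> topspace (Euclidean_space q)" for w
    unfolding topspace_Euclidean_space ambient_deriv_def
    using frechet_derivative_eq_0_if_zero_on_open[OF S]
      frechet_derivative_eq_0_if_zero_on_open[OF S(1) _ zero] by auto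
  have orth: "ip q (?t i) (?t j) = (if i = j then 1 else 0)" for i j
    using f c e unfolding isometric_immersion_def by auto
  have D_comb: "differential c f x (\<Sum>i\<in>UNIV. s i *\<^sub>R e i) = (\<lambda>k. \<Sum>i\<in>UNIV. s i * ?t i k)" for s
    unfolding differential_def
    by (simp add: linear_sum[OF linear_frechet_derivative[OF diff]]
        linear_scale[OF linear_frechet_derivative[OF diff]])
  have "bilinear (metric M c x)"
    using M c unfolding riemannian_manifold_def riemannian_metric_def by blast
  then have expansion: "\<exists>s. v = (\<Sum>i\<in>UNIV. s i *\<^sub>R e i)" for v
    using orthonormal_expansion[of "metric M c x" e v] e by blast
  have range: "range (differential c f x) = {\<lambda>k. \<Sum>i\<in>UNIV. s i * ?t i k |s. True}"
  proof (intro equalityI subsetI)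
    fix b assume "b \<in> range (differential c f x)"
    then obtain v where "b = differential c f x v" by blast
    with expansion[of v] D_comb
    show "b \<in> {\<lambda>k. \<Sum>i\<in>UNIV. s i * ?t i k |s. True}" by auto
  next
    fix b assume "b \<in> {\<lambda>k. \<Sum>i\<in>UNIV. s i * ?t i k |s. True}"
    then show "b \<in> range (differential c f x)"
      by (auto simp: D_comb[symmetric])
  qed
  have B: "second_fundamental_form q f c x u w = (\<lambda>k. ?A w k - (\<Sum>i\<in>UNIV. ip q (?A w) (?t i) * ?t i k))"
    for w
    unfolding second_fundamental_form_def by (rule normal_part_orthonormal[OF range t orth A])
  have A_comb: "?A (\<Sum>i\<in>I. r i *\<^sub>R w i) = (\<lambda>k. \<Sum>i\<in>I. r i * ?A (w i) k)"
    unfolding ambient_deriv_def frechet_derivative_directional[OF S smooth]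
    by (intro ext, simp add: sum_distrib_right sum_distrib_left mult.assoc) (rule sum.swap)
  have "(\<Sum>j\<in>UNIV. (\<Sum>i\<in>I. r i * ip q (?A (w i)) (?t j)) * ?t j k) =
      (\<Sum>i\<in>I. r i * (\<Sum>j\<in>UNIV. ip q (?A (w i)) (?t j) * ?t j k))" for k
    unfolding sum_distrib_right sum_distrib_left
    by (subst sum.swap) (simp add: mult.assoc)
  then show ?thesis
    unfolding B A_comb ip_combination_left by (simp add: right_diff_distrib sum_subtractf)
qed

section \<open>Comparison of the two functionals\<close>

lemma local_orthonormal_frame_at_point:
  assumes "chart_on X c" "x \<in> fst c" "local_orthonormal_frame M c x E"
  shows "metric M c x (E i (snd c x)) (E j (snd c x)) = (if i = j then 1 else 0)"
proof -
  have "topspace (subtopology X (fst c)) = fst c"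
    using assms(1) openin_subset unfolding chart_on_def topspace_subtopology by blast
  then have "inj_on (snd c) (fst c)"
    using assms(1) homeomorphic_imp_injective_map unfolding chart_on_def by metis
  then have "chart_inv c (snd c x) = x"
    using assms(2) by (simp add: chart_inv_def)
  then show ?thesis
    using assms(3) unfolding local_orthonormal_frame_def by metis
qed

lemma F_p_le_F_Phi3:
  fixes M :: "('a, 'm::finite) riem"
  assumes M: "riemannian_manifold M" and f: "isometric_immersion M q f"
    and c: "c \<in> atlas M" "x \<in> fst c" and v: "metric M c x v v = 1"
    and E: "local_orthonormal_frame M c x E" and p: "p \<le> 6"
  shows "F_p p q f c x E v \<le> F_Phi3 q f c x E v"
proof -
  define e where "e i = E i (snd c x)" for i
  define B where "B = second_fundamental_form q f c x"
  have "chart_on (mtop M) c"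
    using M c by (auto simp: riemannian_manifold_def smooth_manifold_def)
  then have orth: "metric M c x (e i) (e j) = (if i = j then 1 else 0)" for i j
    unfolding e_def using c(2) E by (rule local_orthonormal_frame_at_point)
  have "bilinear (metric M c x)"
    using M c unfolding riemannian_manifold_def riemannian_metric_def by blast
  from orthonormal_expansion[OF this orth, of v] v
  obtain a where a: "v = (\<Sum>i\<in>UNIV. a i *\<^sub>R e i)" "(\<Sum>i\<in>UNIV. (a i)\<^sup>2) = 1"
    by auto
  have "B v v = (\<lambda>k. \<Sum>i\<in>UNIV. a i * B v (e i) k)"
    using second_fundamental_form_combination[OF M f c orth, where u = v and I = UNIV and r = a and w = e]
    unfolding B_def a(1)[symmetric] .
  then have CS: "ip q (B v v) (B v v) \<le> (\<Sum>i\<in>UNIV. ip q (B v (e i)) (B v (e i)))"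
    using ip_combination_le[OF a(2), of q "\<lambda>i. B v (e i)"] by simp
  have "(p - 2) * ip q (B v v) (B v v) \<le> 4 * ip q (B v v) (B v v)"
    using p by (intro mult_right_mono) (auto simp: ip_def intro: sum_nonneg)
  with CS have "(p - 2) * ip q (B v v) (B v v) \<le> 4 * (\<Sum>i\<in>UNIV. ip q (B v (e i)) (B v (e i)))"
    by linarith
  then show ?thesis
    unfolding F_p_def F_Phi3_def Let_def e_def[symmetric] B_def[symmetric]
    by (simp add: sum_subtractf sum_distrib_left[symmetric])
qed

theorem theorem5p5:
  fixes M :: "('a, 'm::finite) riem" and p :: real
  assumes "riemannian_manifold M" and "Phi3_SSU M" and "2 \<le> p" and "p \<le> 6"
  shows "p_SSU p M"
proof -
  obtain q f where f: "isometric_immersion M q f"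
    and neg: "\<And>c x v E. c \<in> atlas M \<Longrightarrow> x \<in> fst c \<Longrightarrow> metric M c x v v = 1 \<Longrightarrow>
      local_orthonormal_frame M c x E \<Longrightarrow> F_Phi3 q f c x E v < 0"
    using assms(2) unfolding Phi3_SSU_def by blast
  have "F_p p q f c x E v < 0"
    if "c \<in> atlas M" "x \<in> fst c" "metric M c x v v = 1" "local_orthonormal_frame M c x E" for c x v E
    using F_p_le_F_Phi3[OF assms(1) f that assms(4)] neg[OF that] by linarith
  then show ?thesis
    using f unfolding p_SSU_def by blast
qed

end
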